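(* Let $d$ be a positive integer and let $G*o$ be a coning of a finite simple graph $G$. Then $c^*_{d}(G) = c_{d+1}(G*o)$, where $c^*_d$ denotes the spherical $d$-realisation number and $c_{d+1}$ denotes the $(d+1)$-realisation number.
   Context: Graphs $G=(V,E)$ are finite and simple. The cone $G*o$ of $G$ by a new vertex $o\notin V$ is the graph with vertex set $V\cup\{o\}$ and edge set $E\cup\{ov:v\in V\}$. For $x\in\mathbb{C}^n$ write $[x]_i$ for its $i$-th coordinate, $x\cdot y=\sum_i [x]_i[y]_i$ (bilinear, no conjugation) and $\|x\|^2 = x\cdot x$ (a complex-valued quadratic form). $O(n,\mathbb{C})$ is the group of complex $n\times n$ matrices $M$ with $M^TM=MM^T=I$. A property holds for a general point of an irreducible algebraic set if it holds on some non-empty Zariski open subset. Infinite cardinalities are all identified with $\infty$. $d$-realisation number (for any positive integer $d$ and graph $G=(V,E)$). Let $f_{G,d}:(\mathbb{C}^d)^V\to\mathbb{C}^E$, $p\mapsto(\tfrac12\|p_v-p_w\|^2)_{vw\in E}$. Two realisations $p,q\in(\mathbb{C}^d)^V$ are congruent ($p\sim q$) if there are $A\in O(d,\mathbb{C})$ and $x\in\mathbb{C}^d$ with $p_v=Aq_v+x$ for all $v\in V$. Let $C_d(G,p):=f_{G,d}^{-1}(f_{G,d}(p))/_\sim$. If $|V|\ge d+1$, then $c_d(G):=|C_d(G,p)|$ for a general $p\in(\mathbb{C}^d)^V$ (this value in $\mathbb{N}\cup\{\infty\}$ is constant on a non-empty Zariski open set). If $|V|\le d$, then $c_d(G):=1$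 if $G$ is complete and $c_d(G):=\infty$ otherwise. Spherical $d$-realisation number. Let $\mathbb{S}^d_{\mathbb{C}}:=\{x\in\mathbb{C}^{d+1}:\|x\|^2=1\}$ and $s_{G,d}:(\mathbb{S}^d_{\mathbb{C}})^V\to\mathbb{C}^E$, $p\mapsto(\tfrac12\|p_v-p_w\|^2)_{vw\in E}$. Two spherical realisations $p,q\in(\mathbb{S}^d_{\mathbb{C}})^V$ are congruent if there is $A\in O(d+1,\mathbb{C})$ with $p_v=Aq_v$ for all $v\in V$. Let $C^*_d(G,p):=s_{G,d}^{-1}(s_{G,d}(p))/_\sim$. If $|V|\ge d+1$, then $c^*_d(G):=|C^*_d(G,p)|$ for a general $p\in(\mathbb{S}^d_{\mathbb{C}})^V$ (again constant on a non-empty Zariski open set). If $|V|\le d$, then $c_d^*(G):=1$ if $G$ is complete and $c_d^*(G):=\infty$ otherwise. *)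

theory Defs
  imports Complex_Main "HOL-Library.FuncSet" "HOL-Library.Extended_Nat"
    "Jordan_Normal_Form.Matrix"
begin

section \<open>Graphs and cones\<close>

record 'a graph =
  verts :: "'a set"
  edges :: "'a set set"

definition finite_simple_graph :: "'a graph \<Rightarrow> bool" where
  "finite_simple_graph G \<longleftrightarrow>
     finite (verts G) \<and> (\<forall>e\<in>edges G. e \<subseteq> verts G \<and> card e = 2)"

definition complete_graph :: "'a graph \<Rightarrow> bool" where
  "complete_graph G \<longleftrightarrow> (\<forall>v\<in>verts G. \<forall>w\<in>verts G. v \<noteq> w \<longrightarrow> {v, w} \<in> edges G)"

definition cone :: "'a graph \<Rightarrow> 'a \<Rightarrow> 'a graph" where
  "cone G z = \<lparr>verts = insert z (verts G), edges = edges G \<union> {{z, v} | v. v \<in> verts G}\<rparr>"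


section \<open>Realisations and edge measurements\<close>

text \<open>Vectors and matrices over the complex numbers are indexed from \<open>0\<close>, and
  \<open>\<bullet>\<close> is the bilinear (not the Hermitian) product.\<close>

definition qnorm :: "complex vec \<Rightarrow> complex" where
  "qnorm x = x \<bullet> x"

definition complex_orthogonal_group :: "nat \<Rightarrow> complex mat set" where
  "complex_orthogonal_group n =
     {M \<in> carrier_mat n n. transpose_mat M * M = 1\<^sub>m n \<and> M * transpose_mat M = 1\<^sub>m n}"

definition complex_sphere :: "nat \<Rightarrow> complex vec set" where
  "complex_sphere d = {x \<in> carrier_vec (d + 1). qnorm x = 1}"

definition realisations :: "nat \<Rightarrow> 'a graph \<Rightarrow> ('a \<Rightarrow> complex vec) set" where
  "realisations d G = verts G \<rightarrow>\<^sub>E carrier_vec d"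

definition spherical_realisations :: "nat \<Rightarrow> 'a graph \<Rightarrow> ('a \<Rightarrow> complex vec) set" where
  "spherical_realisations d G = verts G \<rightarrow>\<^sub>E complex_sphere d"

text \<open>The measurement map is an element of \<open>\<complex>\<^sup>E\<close>; the value at an edge does not depend on
  the order of its ends (see \<open>measurement_edge\<close> below). Its restrictions to
  \<open>realisations d G\<close> and to \<open>spherical_realisations d G\<close> are the maps
  \<open>f\<^bsub>G,d\<^esub>\<close> and \<open>s\<^bsub>G,d\<^esub>\<close>.\<close>

definition measurement :: "'a graph \<Rightarrow> ('a \<Rightarrow> complex vec) \<Rightarrow> 'a set \<Rightarrow> complex" where
  "measurement G p =
     (\<lambda>e\<in>edges G. THE c. \<exists>v w. e = {v, w} \<and> v \<noteq> w \<and> c = 1/2 * qnorm (p v - p w))"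

definition congruence :: "nat \<Rightarrow> 'a graph \<Rightarrow> (('a \<Rightarrow> complex vec) \<times> ('a \<Rightarrow> complex vec)) set" where
  "congruence d G =
     {(p, q). p \<in> realisations d G \<and> q \<in> realisations d G \<and>
        (\<exists>A\<in>complex_orthogonal_group d. \<exists>x\<in>carrier_vec d. \<forall>v\<in>verts G. p v = A *\<^sub>v q v + x)}"

definition spherical_congruence ::
    "nat \<Rightarrow> 'a graph \<Rightarrow> (('a \<Rightarrow> complex vec) \<times> ('a \<Rightarrow> complex vec)) set" where
  "spherical_congruence d G =
     {(p, q). p \<in> spherical_realisations d G \<and> q \<in> spherical_realisations d G \<and>
        (\<exists>A\<in>complex_orthogonal_group (d + 1). \<forall>v\<in>verts G. p v = A *\<^sub>v q v)}"

definition congruence_classes ::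
    "nat \<Rightarrow> 'a graph \<Rightarrow> ('a \<Rightarrow> complex vec) \<Rightarrow> ('a \<Rightarrow> complex vec) set set" where
  "congruence_classes d G p =
     {q \<in> realisations d G. measurement G q = measurement G p} // congruence d G"

definition spherical_congruence_classes ::
    "nat \<Rightarrow> 'a graph \<Rightarrow> ('a \<Rightarrow> complex vec) \<Rightarrow> ('a \<Rightarrow> complex vec) set set" where
  "spherical_congruence_classes d G p =
     {q \<in> spherical_realisations d G. measurement G q = measurement G p} // spherical_congruence d G"


section \<open>General points\<close>

text \<open>Polynomial functions on \<open>(\<complex>\<^sup>n)\<^sup>V\<close>.\<close>

inductive_set polynomial_functions :: "nat \<Rightarrow> 'a set \<Rightarrow> (('a \<Rightarrow> complex vec) \<Rightarrow> complex) set"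
  for n :: nat and V :: "'a set" where
  const: "(\<lambda>p. c) \<in> polynomial_functions n V"
| coordinate: "v \<in> V \<Longrightarrow> i < n \<Longrightarrow> (\<lambda>p. p v $ i) \<in> polynomial_functions n V"
| add: "f \<in> polynomial_functions n V \<Longrightarrow> g \<in> polynomial_functions n V \<Longrightarrow>
    (\<lambda>p. f p + g p) \<in> polynomial_functions n V"
| mult: "f \<in> polynomial_functions n V \<Longrightarrow> g \<in> polynomial_functions n V \<Longrightarrow>
    (\<lambda>p. f p * g p) \<in> polynomial_functions n V"

text \<open>The Zariski topology on a subset \<open>X\<close> of \<open>(\<complex>\<^sup>n)\<^sup>V\<close>.\<close>

definition zariski_closed_in ::
    "nat \<Rightarrow> 'a set \<Rightarrow> ('a \<Rightarrow> complex vec) set \<Rightarrow> ('a \<Rightarrow> complex vec) set \<Rightarrow> bool" where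
  "zariski_closed_in n V X Z \<longleftrightarrow>
     (\<exists>F \<subseteq> polynomial_functions n V. Z = {p \<in> X. \<forall>f\<in>F. f p = 0})"

definition zariski_open_in ::
    "nat \<Rightarrow> 'a set \<Rightarrow> ('a \<Rightarrow> complex vec) set \<Rightarrow> ('a \<Rightarrow> complex vec) set \<Rightarrow> bool" where
  "zariski_open_in n V X U \<longleftrightarrow> U \<subseteq> X \<and> zariski_closed_in n V X (X - U)"

definition holds_generally ::
    "nat \<Rightarrow> 'a set \<Rightarrow> ('a \<Rightarrow> complex vec) set \<Rightarrow> (('a \<Rightarrow> complex vec) \<Rightarrow> bool) \<Rightarrow> bool" where
  "holds_generally n V X P \<longleftrightarrow> (\<exists>U. zariski_open_in n V X U \<and> U \<noteq> {} \<and> (\<forall>p\<in>U. P p))"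


section \<open>Realisation numbers\<close>

definition ecard :: "'b set \<Rightarrow> enat" where
  "ecard S = (if finite S then enat (card S) else \<infinity>)"

text \<open>The definite descriptions below are justified by the fact that the number of congruence
  classes is constant on a non-empty Zariski open set; the constant is unique since the
  realisation spaces are irreducible (for \<open>d > 0\<close> in the spherical case).\<close>

definition realisation_number :: "nat \<Rightarrow> 'a graph \<Rightarrow> enat" where
  "realisation_number d G =
     (if card (verts G) \<ge> d + 1
      then (THE k. holds_generally d (verts G) (realisations d G)
                     (\<lambda>p. ecard (congruence_classes d G p) = k))
      else if complete_graph G then 1 else \<infinity>)"

definition spherical_realisation_number :: "nat \<Rightarrow> 'a graph \<Rightarrow> enat" where
  "spherical_realisation_number d G =
     (if card (verts G) \<ge> d + 1
      then (THE k. holds_generally (d + 1) (verts G) (spherical_realisations d G)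
                     (\<lambda>p. ecard (spherical_congruence_classes d G p) = k))
      else if complete_graph G then 1 else \<infinity>)"

lemma measurement_edge:
  assumes "{v, w} \<in> edges G" "v \<noteq> w" "p v \<in> carrier_vec n" "p w \<in> carrier_vec n"
  shows "measurement G p {v, w} = 1/2 * qnorm (p v - p w)"
proof -
  have sym: "qnorm (p w - p v) = qnorm (p v - p w)"
    using assms(3,4) by (auto simp: qnorm_def scalar_prod_def algebra_simps intro!: sum.cong)
  have "(THE c. \<exists>x y. {v, w} = {x, y} \<and> x \<noteq> y \<and> c = 1/2 * qnorm (p x - p y))
          = 1/2 * qnorm (p v - p w)"
    using assms(2) sym by (intro the_equality) (auto simp: doubleton_eq_iff)
  then show ?thesis
    using assms(1) by (simp add: measurement_def)
qed

end

theory Submission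
  imports Defs "HOL-Computational_Algebra.Polynomial"
begin

text \<open>
  A realisation of the cone can be translated so that its apex \<open>z\<close> lies at the origin. The edges at
  the apex then prescribe \<open>\<parallel>p\<^sub>v\<parallel>\<^sup>2\<close> for every other vertex \<open>v\<close>; if none of these numbers vanishes, choose
  square roots \<open>l\<^sub>v\<close> and write \<open>p\<^sub>v = l\<^sub>v x\<^sub>v\<close> with \<open>x\<^sub>v\<close> on the complex sphere. With \<open>\<parallel>p\<^sub>v\<parallel>\<^sup>2\<close> and
  \<open>\<parallel>p\<^sub>w\<parallel>\<^sup>2\<close> known, prescribing \<open>\<parallel>p\<^sub>v - p\<^sub>w\<parallel>\<^sup>2\<close> amounts to prescribing \<open>p\<^sub>v \<bullet> p\<^sub>w\<close>, hence \<open>x\<^sub>v \<bullet> x\<^sub>w\<close>,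
  hence the spherical measurement. An isometry that fixes the apex is linear and commutes with the
  scaling by the \<open>l\<^sub>v\<close>. So rescaling is a bijection from the congruence classes in the spherical
  fibre of \<open>x\<close> to those in the fibre of \<open>p\<close> (\<open>ecard_congruence_classes_cone\<close>).

  It remains to see that the two meanings of ``general'' agree under \<open>p \<mapsto> x\<close>. This is shown for each
  value \<open>k\<close> separately: the number of classes is generally \<open>k\<close> on the sphere if and only if it is
  generally \<open>k\<close> for the cone. The two realisation numbers are then definite descriptions of the same
  predicate. If there are too few vertices for general points, then coning adds one vertex and one
  dimension, and preserves completeness.

  \<^item> From the cone to the sphere: a non-empty Zariski open set contains a point \<open>p\<close> with all
    \<open>\<parallel>p\<^sub>v - p\<^sub>z\<parallel>\<^sup>2 \<noteq> 0\<close> (\<open>exists_anisotropic\<close>). Freezing its apex and its scalars \<open>l\<^sub>v\<close> gives a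
    polynomial map \<open>y \<mapsto> (p\<^sub>z + l\<^sub>v y\<^sub>v)\<^sub>v\<close> from spherical realisations to realisations of the cone,
    along which the open set is pulled back.

  \<^item> From the sphere to the cone: the normalisation \<open>p \<mapsto> x\<close> involves square roots and is only
    defined up to signs. If \<open>f\<close> is a polynomial in the normalised points, then for each vertex,
    after clearing denominators, \<open>f = a + l\<^sub>v b\<close> where \<open>a\<close> and \<open>b\<close> are polynomials in \<open>p\<^sub>v\<close>. If
    \<open>a\<close> or \<open>b\<close> is non-zero, then \<open>f\<close> is non-zero for one of the two signs of \<open>l\<^sub>v\<close>. Replacing \<open>f\<close>
    by \<open>a\<close> or by \<open>b\<close>, one vertex after another, removes all square roots
    (\<open>eliminate_square_roots\<close>).
\<close>

section \<open>The bilinear form and edge measurements\<close>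

lemma qnorm_smult_diff:
  assumes "x \<in> carrier_vec n" "y \<in> carrier_vec n"
  shows "qnorm (a \<cdot>\<^sub>v x - b \<cdot>\<^sub>v y) = a\<^sup>2 * qnorm x + b\<^sup>2 * qnorm y - 2 * a * b * (x \<bullet> y)"
proof -
  have "qnorm (a \<cdot>\<^sub>v x - b \<cdot>\<^sub>v y) =
      (\<Sum>i = 0..<n. a\<^sup>2 * (x $ i * x $ i) + b\<^sup>2 * (y $ i * y $ i) - 2 * a * b * (x $ i * y $ i))"
    using assms unfolding qnorm_def scalar_prod_def
    by (intro sum.cong) (auto simp: algebra_simps power2_eq_square)
  also have "\<dots> = a\<^sup>2 * qnorm x + b\<^sup>2 * qnorm y - 2 * a * b * (x \<bullet> y)"
    using assms unfolding qnorm_def scalar_prod_def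
    by (simp add: sum.distrib sum_subtractf sum_distrib_left)
  finally show ?thesis .
qed

lemma qnorm_smult: "qnorm (a \<cdot>\<^sub>v x) = a\<^sup>2 * qnorm x"
  by (simp add: qnorm_def power2_eq_square scalar_prod_def sum_distrib_left algebra_simps)

lemma qnorm_minus_commute:
  assumes "x \<in> carrier_vec n" "y \<in> carrier_vec n"
  shows "qnorm (x - y) = qnorm (y - x)"
  using assms by (auto simp: qnorm_def scalar_prod_def algebra_simps intro!: sum.cong)

lemma qnorm_eq_sum:
  assumes "x \<in> carrier_vec n"
  shows "qnorm x = (\<Sum>i<n. x $ i * x $ i)"
  using assms by (auto simp: qnorm_def scalar_prod_def atLeast0LessThan)

lemma measurement_eq_iff:
  assumes "finite_simple_graph G" "p \<in> verts G \<rightarrow> carrier_vec n" "q \<in> verts G \<rightarrow> carrier_vec n"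
  shows "measurement G p = measurement G q \<longleftrightarrow>
    (\<forall>v w. {v, w} \<in> edges G \<longrightarrow> v \<noteq> w \<longrightarrow> qnorm (p v - p w) = qnorm (q v - q w))"
proof -
  have ends: "v \<in> verts G" "w \<in> verts G" if "{v, w} \<in> edges G" for v w
    using assms(1) that by (auto simp: finite_simple_graph_def)
  have val: "measurement G r {v, w} = 1/2 * qnorm (r v - r w)"
    if "{v, w} \<in> edges G" "v \<noteq> w" "r \<in> verts G \<rightarrow> carrier_vec n" for r v w
    using that ends[OF that(1)] by (intro measurement_edge[where n = n]) auto
  have two: "\<exists>v w. e = {v, w} \<and> v \<noteq> w" if "e \<in> edges G" for e
    using assms(1) that by (auto simp: finite_simple_graph_def card_2_iff)
  show ?thesis
  proof
    assume "measurement G p = measurement G q"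
    then show "\<forall>v w. {v, w} \<in> edges G \<longrightarrow> v \<noteq> w \<longrightarrow> qnorm (p v - p w) = qnorm (q v - q w)"
      using val assms(2,3) by (metis mult_cancel_left zero_neq_numeral divide_eq_0_iff one_neq_zero)
  next
    assume *: "\<forall>v w. {v, w} \<in> edges G \<longrightarrow> v \<noteq> w \<longrightarrow> qnorm (p v - p w) = qnorm (q v - q w)"
    show "measurement G p = measurement G q"
    proof
      fix e
      show "measurement G p e = measurement G q e"
      proof (cases "e \<in> edges G")
        case True
        with two obtain v w where "e = {v, w}" "v \<noteq> w" by blast
        with True * val assms(2,3) show ?thesis by metis
      next
        case False
        then show ?thesis by (simp add: measurement_def)
      qed
    qed
  qed
qed


section \<open>Cones\<close>

lemma verts_cone [simp]: "verts (cone G z) = insert z (verts G)"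
  by (simp add: cone_def)

lemma finite_simple_graph_cone:
  assumes "finite_simple_graph G" "z \<notin> verts G"
  shows "finite_simple_graph (cone G z)"
proof -
  have "card {z, v} = 2" if "v \<in> verts G" for v
    using that assms(2) by (metis card_2_iff)
  with assms show ?thesis
    by (auto simp: finite_simple_graph_def cone_def)
qed

lemma edge_cone_iff:
  assumes "finite_simple_graph G" "z \<notin> verts G"
  shows "{v, w} \<in> edges (cone G z) \<longleftrightarrow>
    {v, w} \<in> edges G \<or> (v = z \<and> w \<in> verts G) \<or> (w = z \<and> v \<in> verts G)"
  by (auto simp: cone_def doubleton_eq_iff insert_commute)

lemma complete_graph_cone_iff:
  assumes "finite_simple_graph G" "z \<notin> verts G"
  shows "complete_graph (cone G z) \<longleftrightarrow> complete_graph G"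
  using assms(2) unfolding complete_graph_def
  by (auto simp: edge_cone_iff[OF assms])

lemma measurement_cone_eq_iff:
  assumes G: "finite_simple_graph G" "z \<notin> verts G"
    and p: "p \<in> insert z (verts G) \<rightarrow> carrier_vec n" and q: "q \<in> insert z (verts G) \<rightarrow> carrier_vec n"
  shows "measurement (cone G z) p = measurement (cone G z) q \<longleftrightarrow>
    (\<forall>v\<in>verts G. qnorm (p z - p v) = qnorm (q z - q v)) \<and>
    (\<forall>v w. {v, w} \<in> edges G \<longrightarrow> v \<noteq> w \<longrightarrow> qnorm (p v - p w) = qnorm (q v - q w))"
proof -
  have sym: "qnorm (r v - r w) = qnorm (r w - r v)"
    if "r \<in> insert z (verts G) \<rightarrow> carrier_vec n" "v \<in> insert z (verts G)" "w \<in> insert z (verts G)"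
    for r v w
    using that by (intro qnorm_minus_commute[of _ n]) auto
  have "measurement (cone G z) p = measurement (cone G z) q \<longleftrightarrow>
    (\<forall>v w. {v, w} \<in> edges (cone G z) \<longrightarrow> v \<noteq> w \<longrightarrow> qnorm (p v - p w) = qnorm (q v - q w))"
    using p q by (intro measurement_eq_iff[where n = n] finite_simple_graph_cone G) auto
  also have "\<dots> \<longleftrightarrow> (\<forall>v\<in>verts G. qnorm (p z - p v) = qnorm (q z - q v)) \<and>
    (\<forall>v w. {v, w} \<in> edges G \<longrightarrow> v \<noteq> w \<longrightarrow> qnorm (p v - p w) = qnorm (q v - q w))"
    using sym[OF p] sym[OF q] G(2) unfolding edge_cone_iff[OF G] by (metis insertCI)
  finally show ?thesis .
qed


section \<open>Congruence is an equivalence relation\<close>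

lemma orthogonal_one: "1\<^sub>m n \<in> complex_orthogonal_group n"
  by (simp add: complex_orthogonal_group_def)

lemma orthogonal_transpose:
  "A \<in> complex_orthogonal_group n \<Longrightarrow> transpose_mat A \<in> complex_orthogonal_group n"
  by (simp add: complex_orthogonal_group_def)

lemma orthogonal_mult:
  assumes "A \<in> complex_orthogonal_group n" "B \<in> complex_orthogonal_group n"
  shows "A * B \<in> complex_orthogonal_group n"
proof -
  have A: "A \<in> carrier_mat n n" "transpose_mat A * A = 1\<^sub>m n" "A * transpose_mat A = 1\<^sub>m n"
    and B: "B \<in> carrier_mat n n" "transpose_mat B * B = 1\<^sub>m n" "B * transpose_mat B = 1\<^sub>m n"
    using assms by (auto simp: complex_orthogonal_group_def)
  have T: "transpose_mat (A * B) = transpose_mat B * transpose_mat A"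
    using A B by (simp add: transpose_mult)
  have "(transpose_mat B * transpose_mat A) * (A * B) = transpose_mat B * ((transpose_mat A * A) * B)"
    using A(1) B(1) by (simp add: assoc_mult_mat[of _ n n _ n _ n])
  moreover have "(A * B) * (transpose_mat B * transpose_mat A) = A * ((B * transpose_mat B) * transpose_mat A)"
    using A(1) B(1) by (simp add: assoc_mult_mat[of _ n n _ n _ n])
  ultimately show ?thesis
    using A B by (simp add: complex_orthogonal_group_def T)
qed

lemma orthogonal_transpose_mult_vec:
  assumes "A \<in> complex_orthogonal_group n" "x \<in> carrier_vec n"
  shows "transpose_mat A *\<^sub>v (A *\<^sub>v x) = x"
  using assms by (simp add: complex_orthogonal_group_def flip: assoc_mult_mat_vec[of _ n n _ n])

lemma spherical_realisation_carrier:
  "x \<in> spherical_realisations d G \<Longrightarrow> v \<in> verts G \<Longrightarrow> x v \<in> carrier_vec (Suc d)"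
  by (auto simp: spherical_realisations_def complex_sphere_def dest!: PiE_mem)

lemma spherical_realisation_qnorm:
  "x \<in> spherical_realisations d G \<Longrightarrow> v \<in> verts G \<Longrightarrow> qnorm (x v) = 1"
  by (auto simp: spherical_realisations_def complex_sphere_def dest!: PiE_mem)

lemma equiv_spherical_congruence: "equiv (spherical_realisations d G) (spherical_congruence d G)"
proof (rule equivI)
  note car = spherical_realisation_carrier
  show "spherical_congruence d G \<subseteq> spherical_realisations d G \<times> spherical_realisations d G"
    by (auto simp: spherical_congruence_def)
  show "refl_on (spherical_realisations d G) (spherical_congruence d G)"
    by (auto simp: spherical_congruence_def car intro!: refl_onI bexI[OF _ orthogonal_one])
  show "sym (spherical_congruence d G)"
  proof (rule symI)
    fix p q
    assume pq: "(p, q) \<in> spherical_congruence d G"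
    then obtain A where A: "A \<in> complex_orthogonal_group (Suc d)"
      and eq: "\<And>v. v \<in> verts G \<Longrightarrow> p v = A *\<^sub>v q v"
      by (auto simp: spherical_congruence_def)
    have "q v = transpose_mat A *\<^sub>v p v" if "v \<in> verts G" for v
      using pq that car[of q d G v] orthogonal_transpose_mult_vec[OF A, of "q v"]
      by (auto simp: spherical_congruence_def eq)
    then show "(q, p) \<in> spherical_congruence d G"
      using pq orthogonal_transpose[OF A] by (auto simp: spherical_congruence_def)
  qed
  show "trans (spherical_congruence d G)"
  proof (rule transI)
    fix p q r
    assume pqr: "(p, q) \<in> spherical_congruence d G" "(q, r) \<in> spherical_congruence d G"
    then obtain A B where AB: "A \<in> complex_orthogonal_group (Suc d)" "B \<in> complex_orthogonal_group (Suc d)"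
      and eq: "\<And>v. v \<in> verts G \<Longrightarrow> p v = A *\<^sub>v q v" "\<And>v. v \<in> verts G \<Longrightarrow> q v = B *\<^sub>v r v"
      by (auto simp: spherical_congruence_def)
    have "p v = (A * B) *\<^sub>v r v" if "v \<in> verts G" for v
    proof -
      have "r v \<in> carrier_vec (Suc d)" using pqr that car by (auto simp: spherical_congruence_def)
      moreover have "A \<in> carrier_mat (Suc d) (Suc d)" "B \<in> carrier_mat (Suc d) (Suc d)"
        using AB by (auto simp: complex_orthogonal_group_def)
      ultimately show ?thesis using eq[OF that] by (simp add: assoc_mult_mat_vec)
    qed
    then show "(p, r) \<in> spherical_congruence d G"
      using pqr orthogonal_mult[OF AB] by (auto simp: spherical_congruence_def)
  qed
qed

lemma equiv_congruence: "equiv (realisations d G) (congruence d G)"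
proof (rule equivI)
  have car: "p v \<in> carrier_vec d" if "p \<in> realisations d G" "v \<in> verts G" for p v
    using that by (auto simp: realisations_def)
  show "congruence d G \<subseteq> realisations d G \<times> realisations d G"
    by (auto simp: congruence_def)
  show "refl_on (realisations d G) (congruence d G)"
    using car
    by (auto simp: congruence_def intro!: refl_onI bexI[OF _ orthogonal_one] bexI[of _ "0\<^sub>v d"])
  show "sym (congruence d G)"
  proof (rule symI)
    fix p q
    assume pq: "(p, q) \<in> congruence d G"
    then obtain A x where A: "A \<in> complex_orthogonal_group d" and x: "x \<in> carrier_vec d"
      and eq: "\<And>v. v \<in> verts G \<Longrightarrow> p v = A *\<^sub>v q v + x"
      by (auto simp: congruence_def)
    have A': "A \<in> carrier_mat d d" using A by (simp add: complex_orthogonal_group_def)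
    have "q v = transpose_mat A *\<^sub>v p v + - (transpose_mat A *\<^sub>v x)" if "v \<in> verts G" for v
    proof -
      have q: "q v \<in> carrier_vec d" using pq that car by (auto simp: congruence_def)
      have "transpose_mat A *\<^sub>v p v = q v + transpose_mat A *\<^sub>v x"
        using A' x q by (simp add: eq[OF that] mult_add_distrib_mat_vec[of _ d d]
          orthogonal_transpose_mult_vec[OF A])
      then show ?thesis
        using A' x q by auto
    qed
    moreover have "- (transpose_mat A *\<^sub>v x) \<in> carrier_vec d" using A' x by auto
    ultimately show "(q, p) \<in> congruence d G"
      using pq orthogonal_transpose[OF A] unfolding congruence_def by blast
  qed
  show "trans (congruence d G)"
  proof (rule transI)
    fix p q r
    assume pqr: "(p, q) \<in> congruence d G" "(q, r) \<in> congruence d G"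
    then obtain A B x y where AB: "A \<in> complex_orthogonal_group d" "B \<in> complex_orthogonal_group d"
      and xy: "x \<in> carrier_vec d" "y \<in> carrier_vec d"
      and eq: "\<And>v. v \<in> verts G \<Longrightarrow> p v = A *\<^sub>v q v + x" "\<And>v. v \<in> verts G \<Longrightarrow> q v = B *\<^sub>v r v + y"
      by (auto simp: congruence_def)
    have car_AB: "A \<in> carrier_mat d d" "B \<in> carrier_mat d d"
      using AB by (auto simp: complex_orthogonal_group_def)
    have "p v = (A * B) *\<^sub>v r v + (A *\<^sub>v y + x)" if "v \<in> verts G" for v
    proof -
      have "r v \<in> carrier_vec d" using pqr that car by (auto simp: congruence_def)
      then show ?thesis using eq[OF that] car_AB xy
        by (simp add: assoc_mult_mat_vec mult_add_distrib_mat_vec[of _ d d] assoc_add_vec[of _ d])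
    qed
    moreover have "A *\<^sub>v y + x \<in> carrier_vec d" using car_AB xy by auto
    ultimately show "(p, r) \<in> congruence d G"
      using pqr orthogonal_mult[OF AB] unfolding congruence_def by blast
  qed
qed


section \<open>Comparing the two fibres\<close>

lemma ecard_image_eq:
  assumes "\<And>a b. a \<in> A \<Longrightarrow> b \<in> A \<Longrightarrow> f a = f b \<longleftrightarrow> g a = g b"
  shows "ecard (f ` A) = ecard (g ` A)"
proof -
  have inv: "inv_into A f c \<in> A" "f (inv_into A f c) = c" if "c \<in> f ` A" for c
    using that by (auto simp: inv_into_into f_inv_into_f)
  have "inj_on (\<lambda>c. g (inv_into A f c)) (f ` A)"
  proof (rule inj_onI)
    fix c c'
    assume c: "c \<in> f ` A" "c' \<in> f ` A" and "g (inv_into A f c) = g (inv_into A f c')"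
    then have "f (inv_into A f c) = f (inv_into A f c')"
      using assms[OF inv(1)[OF c(1)] inv(1)[OF c(2)]] by simp
    then show "c = c'" using inv(2)[OF c(1)] inv(2)[OF c(2)] by simp
  qed
  moreover have "g a \<in> (\<lambda>c. g (inv_into A f c)) ` (f ` A)" if "a \<in> A" for a
  proof (rule image_eqI)
    show "g a = g (inv_into A f (f a))"
      using assms[OF that inv(1)[of "f a"]] inv(2)[of "f a"] that by simp
  qed (use that in simp)
  ultimately have bij: "bij_betw (\<lambda>c. g (inv_into A f c)) (f ` A) (g ` A)"
    using inv(1) unfolding bij_betw_def by blast
  show ?thesis
    using bij_betw_finite[OF bij] bij_betw_same_card[OF bij] by (simp add: ecard_def)
qed

text \<open>The map that \<open>F\<close> induces on classes is injective by \<open>rel\<close> and surjective by \<open>onto\<close>.\<close>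

lemma ecard_quotient_eq:
  assumes R: "equiv X R" "A \<subseteq> X" and S: "equiv Y S" "B \<subseteq> Y"
    and F: "\<And>a. a \<in> A \<Longrightarrow> F a \<in> B"
    and onto: "\<And>b. b \<in> B \<Longrightarrow> \<exists>a\<in>A. (b, F a) \<in> S"
    and rel: "\<And>a a'. a \<in> A \<Longrightarrow> a' \<in> A \<Longrightarrow> (F a, F a') \<in> S \<longleftrightarrow> (a, a') \<in> R"
  shows "ecard (A // R) = ecard (B // S)"
proof -
  have "A // R = (\<lambda>a. R `` {a}) ` A" by (auto simp: quotient_def)
  moreover have "B // S = (\<lambda>a. S `` {F a}) ` A"
  proof
    show "B // S \<subseteq> (\<lambda>a. S `` {F a}) ` A"
      using onto equiv_class_eq[OF S(1)] by (fastforce simp: quotient_def)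
    show "(\<lambda>a. S `` {F a}) ` A \<subseteq> B // S"
      using F by (auto simp: quotient_def)
  qed
  moreover have "ecard ((\<lambda>a. R `` {a}) ` A) = ecard ((\<lambda>a. S `` {F a}) ` A)"
  proof (rule ecard_image_eq)
    fix a b assume "a \<in> A" "b \<in> A"
    then show "R `` {a} = R `` {b} \<longleftrightarrow> S `` {F a} = S `` {F b}"
      using F R(2) S(2) rel eq_equiv_class_iff[OF R(1)] eq_equiv_class_iff[OF S(1)]
      by (meson subsetD)
  qed
  ultimately show ?thesis by simp
qed

text \<open>Both sides say that \<open>x\<^sub>v \<bullet> x\<^sub>w = y\<^sub>v \<bullet> y\<^sub>w\<close> on every edge of \<open>G\<close>: on the sphere because
  \<open>\<parallel>x\<^sub>v - x\<^sub>w\<parallel>\<^sup>2 = 2 - 2 (x\<^sub>v \<bullet> x\<^sub>w)\<close>, and on the cone because the spokes have the same lengths in \<open>p\<close>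
  and in \<open>q\<close> while \<open>\<parallel>p\<^sub>v - p\<^sub>w\<parallel>\<^sup>2 = l\<^sub>v\<^sup>2 + l\<^sub>w\<^sup>2 - 2 l\<^sub>v l\<^sub>w (x\<^sub>v \<bullet> x\<^sub>w)\<close>.\<close>

lemma measurement_cone_scaled_iff:
  assumes G: "finite_simple_graph G" "z \<notin> verts G"
    and x: "x \<in> spherical_realisations d G" and y: "y \<in> spherical_realisations d G"
    and p: "p \<in> realisations (Suc d) (cone G z)" and q: "q \<in> realisations (Suc d) (cone G z)"
    and l: "\<And>v. v \<in> verts G \<Longrightarrow> l v \<noteq> 0"
    and px: "\<And>v. v \<in> verts G \<Longrightarrow> p v - p z = l v \<cdot>\<^sub>v x v"
    and qy: "\<And>v. v \<in> verts G \<Longrightarrow> q v - q z = l v \<cdot>\<^sub>v y v"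
  shows "measurement (cone G z) p = measurement (cone G z) q \<longleftrightarrow> measurement G x = measurement G y"
proof -
  have spoke: "qnorm (r z - r v) = (l v)\<^sup>2"
    if "r \<in> realisations (Suc d) (cone G z)" "w \<in> spherical_realisations d G" "v \<in> verts G"
      and "r v - r z = l v \<cdot>\<^sub>v w v" for r w v
  proof -
    have "r v \<in> carrier_vec (Suc d)" "r z \<in> carrier_vec (Suc d)"
      using that by (auto simp: realisations_def)
    then have "qnorm (r z - r v) = qnorm (r v - r z)" by (rule qnorm_minus_commute[rotated])
    then show ?thesis
      using that by (simp add: qnorm_smult spherical_realisation_qnorm)
  qed
  have rim: "qnorm (r u - r v) = (l u)\<^sup>2 + (l v)\<^sup>2 - 2 * l u * l v * (w u \<bullet> w v)"
    if "r \<in> realisations (Suc d) (cone G z)" "w \<in> spherical_realisations d G"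
      and uv: "u \<in> verts G" "v \<in> verts G"
      and "\<And>v. v \<in> verts G \<Longrightarrow> r v - r z = l v \<cdot>\<^sub>v w v" for r w u v
  proof -
    have "r u \<in> carrier_vec (Suc d)" "r v \<in> carrier_vec (Suc d)" "r z \<in> carrier_vec (Suc d)"
      using that by (auto simp: realisations_def)
    then have "r u - r v = (r u - r z) - (r v - r z)" by auto
    also have "\<dots> = l u \<cdot>\<^sub>v w u - l v \<cdot>\<^sub>v w v" using that by simp
    finally show ?thesis
      using qnorm_smult_diff[of "w u" "Suc d" "w v" "l u" "l v"] that
      by (simp add: spherical_realisation_qnorm spherical_realisation_carrier)
  qed
  have sph: "qnorm (w u - w v) = 2 - 2 * (w u \<bullet> w v)"
    if "w \<in> spherical_realisations d G" "u \<in> verts G" "v \<in> verts G" for w u v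
    using qnorm_smult_diff[of "w u" "Suc d" "w v" 1 1] that
    by (simp add: spherical_realisation_qnorm spherical_realisation_carrier)
  have ends: "v \<in> verts G" "w \<in> verts G" if "{v, w} \<in> edges G" for v w
    using G(1) that by (auto simp: finite_simple_graph_def)
  have "measurement (cone G z) p = measurement (cone G z) q \<longleftrightarrow>
     (\<forall>v\<in>verts G. qnorm (p z - p v) = qnorm (q z - q v)) \<and>
     (\<forall>v w. {v, w} \<in> edges G \<longrightarrow> v \<noteq> w \<longrightarrow> qnorm (p v - p w) = qnorm (q v - q w))"
    using p q by (intro measurement_cone_eq_iff[where n = "Suc d"] G) (auto simp: realisations_def)
  also have "\<dots> \<longleftrightarrow> (\<forall>v w. {v, w} \<in> edges G \<longrightarrow> v \<noteq> w \<longrightarrow> x v \<bullet> x w = y v \<bullet> y w)"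
    using spoke[OF p x _ px] spoke[OF q y _ qy] rim[OF p x _ _ px] rim[OF q y _ _ qy] ends l
    by simp
  also have "\<dots> \<longleftrightarrow> (\<forall>v w. {v, w} \<in> edges G \<longrightarrow> v \<noteq> w \<longrightarrow> qnorm (x v - x w) = qnorm (y v - y w))"
    using sph[OF x] sph[OF y] ends by simp
  also have "\<dots> \<longleftrightarrow> measurement G x = measurement G y"
    using x y by (intro measurement_eq_iff[where n = "Suc d", symmetric] G)
      (auto intro: spherical_realisation_carrier)
  finally show ?thesis .
qed

definition scaled_cone ::
    "nat \<Rightarrow> 'a graph \<Rightarrow> 'a \<Rightarrow> ('a \<Rightarrow> complex) \<Rightarrow> ('a \<Rightarrow> complex vec) \<Rightarrow> 'a \<Rightarrow> complex vec" where
  "scaled_cone n G z l x = (\<lambda>v\<in>insert z (verts G). if v = z then 0\<^sub>v n else l v \<cdot>\<^sub>v x v)"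

lemma scaled_cone_simps:
  assumes "z \<notin> verts G"
  shows "scaled_cone n G z l x z = 0\<^sub>v n"
    and "v \<in> verts G \<Longrightarrow> scaled_cone n G z l x v = l v \<cdot>\<^sub>v x v"
  using assms by (auto simp: scaled_cone_def)

lemma scaled_cone_realisation:
  assumes "x \<in> spherical_realisations d G"
  shows "scaled_cone (Suc d) G z l x \<in> realisations (Suc d) (cone G z)"
  using spherical_realisation_carrier[OF assms] by (auto simp: realisations_def scaled_cone_def)

text \<open>The apex sits at the origin in both realisations, so a congruence between them has no
  translation part; its linear part commutes with the scalars \<open>l\<^sub>v\<close>, which can be cancelled.\<close>

lemma scaled_cone_congruent_iff:
  assumes z: "z \<notin> verts G"
    and x: "x \<in> spherical_realisations d G" and y: "y \<in> spherical_realisations d G"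
    and l: "\<And>v. v \<in> verts G \<Longrightarrow> l v \<noteq> 0"
  shows "(scaled_cone (Suc d) G z l x, scaled_cone (Suc d) G z l y) \<in> congruence (Suc d) (cone G z)
    \<longleftrightarrow> (x, y) \<in> spherical_congruence d G" (is "(?F x, ?F y) \<in> _ \<longleftrightarrow> _")
proof
  assume "(?F x, ?F y) \<in> congruence (Suc d) (cone G z)"
  then obtain A t where A: "A \<in> complex_orthogonal_group (Suc d)" and t: "t \<in> carrier_vec (Suc d)"
    and eq: "\<And>v. v \<in> insert z (verts G) \<Longrightarrow> ?F x v = A *\<^sub>v ?F y v + t"
    by (auto simp: congruence_def)
  have A': "A \<in> carrier_mat (Suc d) (Suc d)" using A by (simp add: complex_orthogonal_group_def)
  then have "A *\<^sub>v 0\<^sub>v (Suc d) = 0\<^sub>v (Suc d)" by auto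
  then have t0: "t = 0\<^sub>v (Suc d)"
    using eq[of z] t by (simp add: scaled_cone_simps[OF z])
  have "x v = A *\<^sub>v y v" if "v \<in> verts G" for v
  proof -
    have yv: "y v \<in> carrier_vec (Suc d)" "x v \<in> carrier_vec (Suc d)"
      using x y that by (auto intro: spherical_realisation_carrier)
    then have "l v \<cdot>\<^sub>v x v = l v \<cdot>\<^sub>v (A *\<^sub>v y v)"
      using eq[of v] that A' by (simp add: scaled_cone_simps[OF z] t0 mult_mat_vec[of _ "Suc d" "Suc d"])
    then have "(1 / l v) \<cdot>\<^sub>v (l v \<cdot>\<^sub>v x v) = (1 / l v) \<cdot>\<^sub>v (l v \<cdot>\<^sub>v (A *\<^sub>v y v))" by simp
    then show ?thesis using l[OF that] by (simp add: smult_smult_assoc)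
  qed
  then show "(x, y) \<in> spherical_congruence d G"
    using x y A by (auto simp: spherical_congruence_def)
next
  assume "(x, y) \<in> spherical_congruence d G"
  then obtain A where A: "A \<in> complex_orthogonal_group (Suc d)"
    and eq: "\<And>v. v \<in> verts G \<Longrightarrow> x v = A *\<^sub>v y v"
    by (auto simp: spherical_congruence_def)
  have A': "A \<in> carrier_mat (Suc d) (Suc d)" using A by (simp add: complex_orthogonal_group_def)
  have "?F x v = A *\<^sub>v ?F y v + 0\<^sub>v (Suc d)" if "v \<in> insert z (verts G)" for v
  proof (cases "v = z")
    case True
    have "A *\<^sub>v 0\<^sub>v (Suc d) = 0\<^sub>v (Suc d)" using A' by auto
    then show ?thesis using True by (simp add: scaled_cone_simps[OF z])
  next
    case False
    then have v: "v \<in> verts G" using that by simp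
    have "y v \<in> carrier_vec (Suc d)" using spherical_realisation_carrier[OF y v] .
    then show ?thesis
      using A' by (simp add: scaled_cone_simps[OF z] v eq[OF v] mult_mat_vec[of _ "Suc d" "Suc d"])
  qed
  then show "(?F x, ?F y) \<in> congruence (Suc d) (cone G z)"
    using A scaled_cone_realisation[OF x] scaled_cone_realisation[OF y]
    by (auto simp: congruence_def intro!: bexI[OF _ A] bexI[of _ "0\<^sub>v (Suc d)"])
qed

text \<open>The map \<open>y \<mapsto> scaled_cone (Suc d) G z l y\<close> sends the spherical fibre of \<open>x\<close> into the fibre of
  \<open>p\<close>, respects and reflects congruence, and meets every congruence class: a realisation \<open>q\<close> in the
  fibre of \<open>p\<close> satisfies \<open>\<parallel>q\<^sub>v - q\<^sub>z\<parallel>\<^sup>2 = l\<^sub>v\<^sup>2\<close>, so that \<open>(q\<^sub>v - q\<^sub>z) / l\<^sub>v\<close> lies on the sphere.\<close>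

lemma ecard_congruence_classes_cone:
  assumes G: "finite_simple_graph G" "z \<notin> verts G"
    and x: "x \<in> spherical_realisations d G" and p: "p \<in> realisations (Suc d) (cone G z)"
    and l: "\<And>v. v \<in> verts G \<Longrightarrow> l v \<noteq> 0"
    and px: "\<And>v. v \<in> verts G \<Longrightarrow> p v - p z = l v \<cdot>\<^sub>v x v"
  shows "ecard (congruence_classes (Suc d) (cone G z) p) = ecard (spherical_congruence_classes d G x)"
proof -
  let ?F = "scaled_cone (Suc d) G z l"
  let ?A = "{y \<in> spherical_realisations d G. measurement G y = measurement G x}"
  let ?B = "{q \<in> realisations (Suc d) (cone G z). measurement (cone G z) q = measurement (cone G z) p}"
  have F: "?F y v - ?F y z = l v \<cdot>\<^sub>v y v" if "y \<in> spherical_realisations d G" "v \<in> verts G" for y v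
    using spherical_realisation_carrier[OF that] that(2) by (simp add: scaled_cone_simps[OF G(2)])
  have "ecard (?A // spherical_congruence d G) = ecard (?B // congruence (Suc d) (cone G z))"
  proof (rule ecard_quotient_eq[where F = ?F, OF equiv_spherical_congruence _ equiv_congruence])
    show "?F y \<in> ?B" if "y \<in> ?A" for y
      using that measurement_cone_scaled_iff[OF G _ x scaled_cone_realisation p l F px]
      by (simp add: scaled_cone_realisation[simplified])
    show "(?F y, ?F y') \<in> congruence (Suc d) (cone G z) \<longleftrightarrow> (y, y') \<in> spherical_congruence d G"
      if "y \<in> ?A" "y' \<in> ?A" for y y'
      using that by (intro scaled_cone_congruent_iff[OF G(2) _ _ l]) auto
    show "\<exists>y\<in>?A. (q, ?F y) \<in> congruence (Suc d) (cone G z)" if "q \<in> ?B" for q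
    proof -
      have q: "q \<in> realisations (Suc d) (cone G z)"
        and meas: "measurement (cone G z) q = measurement (cone G z) p" using that by auto
      have car: "r v \<in> carrier_vec (Suc d)"
        if "r \<in> realisations (Suc d) (cone G z)" "v \<in> insert z (verts G)" for r v
        using that by (auto simp: realisations_def)
      define y where "y = (\<lambda>v\<in>verts G. (1 / l v) \<cdot>\<^sub>v (q v - q z))"
      have sym: "qnorm (r z - r v) = qnorm (r v - r z)"
        if "r \<in> realisations (Suc d) (cone G z)" "v \<in> verts G" for r v
        using car[OF that(1), of v] car[OF that(1), of z] that(2)
        by (intro qnorm_minus_commute[of _ "Suc d"]) auto
      have "qnorm (q v - q z) = (l v)\<^sup>2" if v: "v \<in> verts G" for v
      proof -
        have "qnorm (q z - q v) = qnorm (p z - p v)"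
          using meas measurement_cone_eq_iff[OF G, of q "Suc d" p] car[OF q] car[OF p] v by blast
        then show ?thesis
          using sym[OF q v] sym[OF p v] px[OF v] x v
          by (simp add: qnorm_smult spherical_realisation_qnorm)
      qed
      then have "qnorm (y v) = 1" if "v \<in> verts G" for v
        using that l[OF that] by (simp add: y_def qnorm_smult power_divide)
      moreover have "y v \<in> carrier_vec (Suc d)" if "v \<in> verts G" for v
        using that car[OF q, of v] car[OF q, of z] by (simp add: y_def)
      ultimately have y: "y \<in> spherical_realisations d G"
        by (auto simp: spherical_realisations_def complex_sphere_def) (simp_all add: y_def)
      have qy: "q v - q z = l v \<cdot>\<^sub>v y v" if "v \<in> verts G" for v
        using that l[OF that] by (simp add: y_def smult_smult_assoc)
      have "measurement G y = measurement G x"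
        using measurement_cone_scaled_iff[OF G y x q p l qy px] meas by simp
      moreover have "(q, ?F y) \<in> congruence (Suc d) (cone G z)"
      proof -
        have eq: "q v = 1\<^sub>m (Suc d) *\<^sub>v ?F y v + q z" if v: "v \<in> insert z (verts G)" for v
        proof -
          have "?F y v = q v - q z"
            using v car[OF q, of z] qy F[OF y] by (auto simp: scaled_cone_simps[OF G(2)])
          then show ?thesis using car[OF q v] car[OF q, of z] by auto
        qed
        have "\<exists>A\<in>complex_orthogonal_group (Suc d). \<exists>t\<in>carrier_vec (Suc d).
            \<forall>v\<in>verts (cone G z). q v = A *\<^sub>v ?F y v + t"
          by (intro bexI[OF _ orthogonal_one] bexI[of _ "q z"] ballI eq) (simp_all add: car[OF q])
        then show ?thesis
          using q scaled_cone_realisation[OF y] unfolding congruence_def by blast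
      qed
      ultimately show ?thesis using y by blast
    qed
  qed auto
  then show ?thesis
    by (simp add: congruence_classes_def spherical_congruence_classes_def)
qed


section \<open>Polynomial functions\<close>

text \<open>The sets \<open>{f \<noteq> 0}\<close> for a single polynomial \<open>f\<close> form a basis of the Zariski topology.\<close>

lemma holds_generally_iff:
  "holds_generally n V X P \<longleftrightarrow>
    (\<exists>f\<in>polynomial_functions n V. (\<exists>p\<in>X. f p \<noteq> 0) \<and> (\<forall>p\<in>X. f p \<noteq> 0 \<longrightarrow> P p))"
proof
  assume "holds_generally n V X P"
  then obtain U F where U: "U \<subseteq> X" "U \<noteq> {}" "\<forall>p\<in>U. P p"
    and F: "F \<subseteq> polynomial_functions n V" "X - U = {p \<in> X. \<forall>f\<in>F. f p = 0}"
    unfolding holds_generally_def zariski_open_in_def zariski_closed_in_def by blast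
  obtain p f where "p \<in> X" "f \<in> F" "f p \<noteq> 0"
    using U F by blast
  with U F show "\<exists>f\<in>polynomial_functions n V. (\<exists>p\<in>X. f p \<noteq> 0) \<and> (\<forall>p\<in>X. f p \<noteq> 0 \<longrightarrow> P p)"
    by blast
next
  assume "\<exists>f\<in>polynomial_functions n V. (\<exists>p\<in>X. f p \<noteq> 0) \<and> (\<forall>p\<in>X. f p \<noteq> 0 \<longrightarrow> P p)"
  then obtain f where f: "f \<in> polynomial_functions n V" "\<exists>p\<in>X. f p \<noteq> 0" "\<forall>p\<in>X. f p \<noteq> 0 \<longrightarrow> P p"
    by blast
  have "X - {p \<in> X. f p \<noteq> 0} = {p \<in> X. \<forall>f'\<in>{f}. f' p = 0}" by auto
  then have "zariski_open_in n V X {p \<in> X. f p \<noteq> 0}"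
    using f(1) unfolding zariski_open_in_def zariski_closed_in_def by blast
  then show "holds_generally n V X P"
    using f unfolding holds_generally_def by blast
qed

lemma polynomial_functions_diff:
  assumes "f \<in> polynomial_functions n V" "g \<in> polynomial_functions n V"
  shows "(\<lambda>p. f p - g p) \<in> polynomial_functions n V"
  using polynomial_functions.add[OF assms(1) polynomial_functions.mult
      [OF polynomial_functions.const[of "- 1"] assms(2)]] by simp

lemma polynomial_functions_sum:
  assumes "finite I" "\<And>i. i \<in> I \<Longrightarrow> f i \<in> polynomial_functions n V"
  shows "(\<lambda>p. \<Sum>i\<in>I. f i p) \<in> polynomial_functions n V"
  using assms by (induction I rule: finite_induct) (auto intro: polynomial_functions.intros)

lemma polynomial_functions_prod:
  assumes "finite I" "\<And>i. i \<in> I \<Longrightarrow> f i \<in> polynomial_functions n V"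
  shows "(\<lambda>p. \<Prod>i\<in>I. f i p) \<in> polynomial_functions n V"
  using assms by (induction I rule: finite_induct) (auto intro: polynomial_functions.intros)

lemma polynomial_functions_power:
  assumes "f \<in> polynomial_functions n V"
  shows "(\<lambda>p. f p ^ k) \<in> polynomial_functions n V"
  using polynomial_functions_prod[of "{..<k}" "\<lambda>_. f" n V] assms by simp

text \<open>The set \<open>X\<close> confines the claim to vectors of the right dimension; only for these are the
  coordinates of a sum the sums of the coordinates.\<close>

lemma polynomial_substitution:
  assumes "f \<in> polynomial_functions n V"
    and "\<And>v i. v \<in> V \<Longrightarrow> i < n \<Longrightarrow> \<exists>h\<in>polynomial_functions m U. \<forall>p\<in>X. T p v $ i = h p"
  shows "\<exists>g\<in>polynomial_functions m U. \<forall>p\<in>X. f (T p) = g p"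
  using assms(1)
proof (induction rule: polynomial_functions.induct)
  case (const c)
  then show ?case by (intro bexI[of _ "\<lambda>_. c"]) (auto intro: polynomial_functions.intros)
next
  case (coordinate v i)
  then show ?case using assms(2) by blast
next
  case (add f1 f2)
  then obtain g1 g2 where "g1 \<in> polynomial_functions m U" "\<forall>p\<in>X. f1 (T p) = g1 p"
    "g2 \<in> polynomial_functions m U" "\<forall>p\<in>X. f2 (T p) = g2 p" by blast
  then show ?case
    by (intro bexI[of _ "\<lambda>p. g1 p + g2 p"]) (auto intro: polynomial_functions.intros)
next
  case (mult f1 f2)
  then obtain g1 g2 where "g1 \<in> polynomial_functions m U" "\<forall>p\<in>X. f1 (T p) = g1 p"
    "g2 \<in> polynomial_functions m U" "\<forall>p\<in>X. f2 (T p) = g2 p" by blast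
  then show ?case
    by (intro bexI[of _ "\<lambda>p. g1 p * g2 p"]) (auto intro: polynomial_functions.intros)
qed

lemma polynomial_on_line:
  assumes "f \<in> polynomial_functions n V"
    and "p \<in> V \<rightarrow> carrier_vec n" "u \<in> V \<rightarrow> carrier_vec n"
  shows "\<exists>P. \<forall>t. f (\<lambda>v\<in>V. p v + t \<cdot>\<^sub>v u v) = poly P t"
  using assms(1)
proof (induction rule: polynomial_functions.induct)
  case (const c)
  show ?case by (intro exI[of _ "[:c:]"]) simp
next
  case (coordinate v i)
  have "p v \<in> carrier_vec n" "u v \<in> carrier_vec n" using assms coordinate by auto
  then show ?case
    using coordinate by (intro exI[of _ "[:p v $ i, u v $ i:]"]) simp
next
  case (add f1 f2)
  then show ?case by (metis poly_add)
next
  case (mult f1 f2)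
  then show ?case by (metis poly_mult)
qed

lemma qnorm_polynomial:
  fixes v :: 'a
  assumes "v \<in> V"
  shows "\<exists>h\<in>polynomial_functions n V. \<forall>p\<in>V \<rightarrow> carrier_vec n. qnorm (p v) = h p"
proof (intro bexI ballI)
  fix p :: "'a \<Rightarrow> complex vec" assume "p \<in> V \<rightarrow> carrier_vec n"
  then show "qnorm (p v) = (\<Sum>i<n. p v $ i * p v $ i)"
    using assms by (intro qnorm_eq_sum) auto
qed (use assms in \<open>auto intro!: polynomial_functions_sum polynomial_functions.intros\<close>)

lemma qnorm_diff_polynomial:
  fixes v :: 'a
  assumes "v \<in> V" "z \<in> V"
  shows "\<exists>h\<in>polynomial_functions n V. \<forall>p\<in>V \<rightarrow> carrier_vec n. qnorm (p v - p z) = h p"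
proof (intro bexI ballI)
  fix p :: "'a \<Rightarrow> complex vec" assume p: "p \<in> V \<rightarrow> carrier_vec n"
  then have "p v \<in> carrier_vec n" "p z \<in> carrier_vec n" using assms by auto
  then show "qnorm (p v - p z) = (\<Sum>i<n. (p v $ i - p z $ i) * (p v $ i - p z $ i))"
    by (subst qnorm_eq_sum[of _ n]) auto
qed (use assms in \<open>auto intro!: polynomial_functions_sum polynomial_functions_diff
  polynomial_functions.intros\<close>)


section \<open>Anisotropic spokes are generic\<close>

lemma qnorm_line:
  assumes "a \<in> carrier_vec n" "0 < n"
  shows "qnorm (a + t \<cdot>\<^sub>v unit_vec n 0) = poly [:qnorm a, 2 * a $ 0, 1:] t"
proof -
  have "qnorm (a + t \<cdot>\<^sub>v unit_vec n 0) =
      (\<Sum>i<n. a $ i * a $ i + (if i = 0 then 2 * t * a $ 0 + t * t else 0))"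
    using assms by (subst qnorm_eq_sum[of _ n]) (auto simp: unit_vec_def algebra_simps intro!: sum.cong)
  also have "\<dots> = qnorm a + (2 * t * a $ 0 + t * t)"
    using assms by (simp add: sum.distrib qnorm_eq_sum)
  finally show ?thesis by (simp add: algebra_simps)
qed

text \<open>Move all points but \<open>z\<close> with equal speed in the direction of the first unit vector. Along this
  line, \<open>f\<close> is a polynomial in one variable that does not vanish at \<open>0\<close>, and each
  \<open>\<parallel>q\<^sub>v - q\<^sub>z\<parallel>\<^sup>2\<close> is a monic quadratic polynomial, since the direction has norm \<open>1\<close>. Finitely many
  parameters are excluded.\<close>

lemma exists_anisotropic:
  fixes V :: "'a set"
  assumes f: "f \<in> polynomial_functions n V" and V: "finite V" "z \<in> V" and n: "0 < n"
    and p: "p \<in> V \<rightarrow>\<^sub>E carrier_vec n" and fp: "f p \<noteq> 0"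
  shows "\<exists>q\<in>V \<rightarrow>\<^sub>E carrier_vec n. f q \<noteq> 0 \<and> (\<forall>v\<in>V - {z}. qnorm (q v - q z) \<noteq> 0)"
proof -
  define u :: "'a \<Rightarrow> complex vec" where "u v = (if v = z then 0\<^sub>v n else unit_vec n 0)" for v
  define q where "q t = (\<lambda>v\<in>V. p v + t \<cdot>\<^sub>v u v)" for t
  have car: "p v \<in> carrier_vec n" if "v \<in> V" for v using p that by auto
  have u: "u v \<in> carrier_vec n" for v by (simp add: u_def)
  obtain P where P: "\<And>t. f (q t) = poly P t"
    using polynomial_on_line[OF f, of p u] car u unfolding q_def by blast
  define R where "R v = [:qnorm (p v - p z), 2 * (p v - p z) $ 0, 1:]" for v
  have R: "qnorm (q t v - q t z) = poly (R v) t" if "v \<in> V - {z}" for t v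
  proof -
    have "q t v - q t z = (p v - p z) + t \<cdot>\<^sub>v unit_vec n 0"
      using that V car[of v] car[of z] by (auto simp: q_def u_def)
    moreover have "p v - p z \<in> carrier_vec n" using that V car[of v] car[of z] by auto
    ultimately show ?thesis using qnorm_line[OF _ n] by (simp add: R_def)
  qed
  have "0 \<cdot>\<^sub>v u v = 0\<^sub>v n" for v using u[of v] by auto
  then have "q 0 = p"
    using p car by (auto simp: q_def fun_eq_iff PiE_def extensional_def)
  then have "P \<noteq> 0" using P[of 0] fp by auto
  moreover have "(\<Prod>v\<in>V - {z}. R v) \<noteq> 0" using V by (simp add: R_def)
  ultimately have "finite {t. poly (P * (\<Prod>v\<in>V - {z}. R v)) t = 0}"
    by (intro poly_roots_finite) simp
  then obtain t where t: "poly (P * (\<Prod>v\<in>V - {z}. R v)) t \<noteq> 0"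
    using infinite_UNIV_char_0[where ?'a = complex] by (metis (mono_tags, lifting) UNIV_eq_I mem_Collect_eq)
  have "q t \<in> V \<rightarrow>\<^sub>E carrier_vec n" using car u by (auto simp: q_def)
  moreover have "f (q t) \<noteq> 0" using t P by simp
  moreover have "\<forall>v\<in>V - {z}. qnorm (q t v - q t z) \<noteq> 0"
    using t R V by (auto simp: poly_prod)
  ultimately show ?thesis by blast
qed


section \<open>Eliminating the square roots\<close>

text \<open>A monomial of degree \<open>m\<close> in \<open>p\<^sub>v\<close> picks up the factor \<open>1 / l ^ m\<close>. Multiplied by a high power of
  \<open>l\<^sup>2 = \<parallel>p\<^sub>v\<parallel>\<^sup>2\<close>, this becomes a power of \<open>\<parallel>p\<^sub>v\<parallel>\<^sup>2\<close>, times \<open>l\<close> if \<open>m\<close> is odd. Hence \<open>a\<close> and \<open>b\<close>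
  come from the parts of \<open>f\<close> of even and of odd degree in \<open>p\<^sub>v\<close>, and they do not depend on the choice
  of the root \<open>l\<close>.\<close>

lemma normalise_one_vertex:
  assumes "f \<in> polynomial_functions n V" and v: "v \<in> V"
  shows "\<exists>a\<in>polynomial_functions n V. \<exists>b\<in>polynomial_functions n V. \<exists>N.
    \<forall>p\<in>V \<rightarrow> carrier_vec n. \<forall>l. l \<noteq> 0 \<longrightarrow> l\<^sup>2 = qnorm (p v) \<longrightarrow>
      qnorm (p v) ^ N * f (p(v := (1 / l) \<cdot>\<^sub>v p v)) = a p + l * b p"
  using assms(1)
proof (induction rule: polynomial_functions.induct)
  case (const c)
  then show ?case
    by - (rule bexI[of _ "\<lambda>_. c"],
        rule bexI[of _ "\<lambda>_. 0"], rule exI[of _ 0],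
        auto intro: polynomial_functions.intros)
next
  case (coordinate w i)
  show ?case
  proof (cases "w = v")
    case True
    have "qnorm (p v) * ((1 / l) \<cdot>\<^sub>v p v) $ i = l * p v $ i"
      if p: "p \<in> V \<rightarrow> carrier_vec n" "l \<noteq> 0" "l\<^sup>2 = qnorm (p v)" for p l
    proof -
      have "p v \<in> carrier_vec n" using p v by auto
      then have "((1 / l) \<cdot>\<^sub>v p v) $ i = p v $ i / l" using coordinate by simp
      then show ?thesis using p(2) by (simp add: p(3)[symmetric] power2_eq_square)
    qed
    then show ?thesis
      using coordinate True
      by - (rule bexI[of _ "\<lambda>_. 0"],
        rule bexI[of _ "\<lambda>p. p v $ i"], rule exI[of _ 1],
        auto intro: polynomial_functions.intros)
  next
    case False
    then show ?thesis
      using coordinate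
      by - (rule bexI[of _ "\<lambda>p. p w $ i"],
        rule bexI[of _ "\<lambda>_. 0"], rule exI[of _ 0],
        auto intro: polynomial_functions.intros)
  qed
next
  case (add f1 f2)
  obtain Q where Q: "Q \<in> polynomial_functions n V" "\<forall>p\<in>V \<rightarrow> carrier_vec n. qnorm (p v) = Q p"
    using qnorm_polynomial[OF v] by blast
  obtain a1 b1 N1 a2 b2 N2 where
    ab: "a1 \<in> polynomial_functions n V" "b1 \<in> polynomial_functions n V"
      "a2 \<in> polynomial_functions n V" "b2 \<in> polynomial_functions n V" and
    eq1: "\<And>p l. p \<in> V \<rightarrow> carrier_vec n \<Longrightarrow> l \<noteq> 0 \<Longrightarrow> l\<^sup>2 = qnorm (p v) \<Longrightarrow>
      qnorm (p v) ^ N1 * f1 (p(v := (1 / l) \<cdot>\<^sub>v p v)) = a1 p + l * b1 p" and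
    eq2: "\<And>p l. p \<in> V \<rightarrow> carrier_vec n \<Longrightarrow> l \<noteq> 0 \<Longrightarrow> l\<^sup>2 = qnorm (p v) \<Longrightarrow>
      qnorm (p v) ^ N2 * f2 (p(v := (1 / l) \<cdot>\<^sub>v p v)) = a2 p + l * b2 p"
    using add.IH by metis
  have "qnorm (p v) ^ (N1 + N2) * (f1 (p(v := (1 / l) \<cdot>\<^sub>v p v)) + f2 (p(v := (1 / l) \<cdot>\<^sub>v p v)))
      = (Q p ^ N2 * a1 p + Q p ^ N1 * a2 p) + l * (Q p ^ N2 * b1 p + Q p ^ N1 * b2 p)"
    if p: "p \<in> V \<rightarrow> carrier_vec n" "l \<noteq> 0" "l\<^sup>2 = qnorm (p v)" for p l
  proof -
    have "qnorm (p v) ^ (N1 + N2) * (f1 (p(v := (1 / l) \<cdot>\<^sub>v p v)) + f2 (p(v := (1 / l) \<cdot>\<^sub>v p v)))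
      = Q p ^ N2 * (qnorm (p v) ^ N1 * f1 (p(v := (1 / l) \<cdot>\<^sub>v p v)))
        + Q p ^ N1 * (qnorm (p v) ^ N2 * f2 (p(v := (1 / l) \<cdot>\<^sub>v p v)))"
      using p(1) Q(2) by (simp add: algebra_simps power_add)
    then show ?thesis unfolding eq1[OF p] eq2[OF p] by (simp add: algebra_simps)
  qed
  then show ?case
    using ab Q(1)
    by - (rule bexI[of _ "\<lambda>p. Q p ^ N2 * a1 p + Q p ^ N1 * a2 p"],
        rule bexI[of _ "\<lambda>p. Q p ^ N2 * b1 p + Q p ^ N1 * b2 p"], rule exI[of _ "N1 + N2"],
        blast, auto intro!: polynomial_functions.add polynomial_functions.mult polynomial_functions_power)
next
  case (mult f1 f2)
  obtain Q where Q: "Q \<in> polynomial_functions n V" "\<forall>p\<in>V \<rightarrow> carrier_vec n. qnorm (p v) = Q p"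
    using qnorm_polynomial[OF v] by blast
  obtain a1 b1 N1 a2 b2 N2 where
    ab: "a1 \<in> polynomial_functions n V" "b1 \<in> polynomial_functions n V"
      "a2 \<in> polynomial_functions n V" "b2 \<in> polynomial_functions n V" and
    eq1: "\<And>p l. p \<in> V \<rightarrow> carrier_vec n \<Longrightarrow> l \<noteq> 0 \<Longrightarrow> l\<^sup>2 = qnorm (p v) \<Longrightarrow>
      qnorm (p v) ^ N1 * f1 (p(v := (1 / l) \<cdot>\<^sub>v p v)) = a1 p + l * b1 p" and
    eq2: "\<And>p l. p \<in> V \<rightarrow> carrier_vec n \<Longrightarrow> l \<noteq> 0 \<Longrightarrow> l\<^sup>2 = qnorm (p v) \<Longrightarrow>
      qnorm (p v) ^ N2 * f2 (p(v := (1 / l) \<cdot>\<^sub>v p v)) = a2 p + l * b2 p"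
    using mult.IH by metis
  have "qnorm (p v) ^ (N1 + N2) * (f1 (p(v := (1 / l) \<cdot>\<^sub>v p v)) * f2 (p(v := (1 / l) \<cdot>\<^sub>v p v)))
      = (a1 p * a2 p + Q p * (b1 p * b2 p)) + l * (a1 p * b2 p + a2 p * b1 p)"
    if p: "p \<in> V \<rightarrow> carrier_vec n" "l \<noteq> 0" "l\<^sup>2 = qnorm (p v)" for p l
  proof -
    have "qnorm (p v) ^ (N1 + N2) * (f1 (p(v := (1 / l) \<cdot>\<^sub>v p v)) * f2 (p(v := (1 / l) \<cdot>\<^sub>v p v)))
      = (qnorm (p v) ^ N1 * f1 (p(v := (1 / l) \<cdot>\<^sub>v p v)))
        * (qnorm (p v) ^ N2 * f2 (p(v := (1 / l) \<cdot>\<^sub>v p v)))"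
      by (simp add: algebra_simps power_add)
    also have "\<dots> = (a1 p + l * b1 p) * (a2 p + l * b2 p)"
      unfolding eq1[OF p] eq2[OF p] ..
    also have "\<dots> = (a1 p * a2 p + l\<^sup>2 * (b1 p * b2 p)) + l * (a1 p * b2 p + a2 p * b1 p)"
      by (simp add: algebra_simps power2_eq_square)
    finally show ?thesis using p Q(2) by simp
  qed
  then show ?case
    using ab Q(1)
    by - (rule bexI[of _ "\<lambda>p. a1 p * a2 p + Q p * (b1 p * b2 p)"],
        rule bexI[of _ "\<lambda>p. a1 p * b2 p + a2 p * b1 p"], rule exI[of _ "N1 + N2"],
        blast, auto intro!: polynomial_functions.add polynomial_functions.mult)
qed

text \<open>The non-vanishing of \<open>g\<close> guarantees some choice of signs for which \<open>f\<close> does not vanish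
  at the normalised point; not every choice need do. Since \<open>x\<close> is already normalised, it remains
  a witness that \<open>g\<close> is not zero on the sphere throughout the induction.\<close>

lemma eliminate_square_roots:
  assumes "finite W" "W \<subseteq> V" and f: "f \<in> polynomial_functions n V"
    and x: "x \<in> V \<rightarrow> carrier_vec n" "\<forall>v\<in>V. qnorm (x v) = 1" "f x \<noteq> 0"
  shows "\<exists>g\<in>polynomial_functions n V. g x \<noteq> 0 \<and>
    (\<forall>p\<in>V \<rightarrow> carrier_vec n. (\<forall>v\<in>W. qnorm (p v) \<noteq> 0) \<longrightarrow> g p \<noteq> 0 \<longrightarrow>
      (\<exists>l. (\<forall>v\<in>W. (l v)\<^sup>2 = qnorm (p v)) \<and>
        f (\<lambda>v. if v \<in> W then (1 / l v) \<cdot>\<^sub>v p v else p v) \<noteq> 0))"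
  using assms(1,2)
proof (induction W rule: finite_induct)
  case empty
  show ?case using f x by (intro bexI[of _ f]) auto
next
  case (insert v W)
  then have "W \<subseteq> V" by simp
  from insert.IH[OF this] obtain g where g: "g \<in> polynomial_functions n V" and
    g_prop: "g x \<noteq> 0 \<and> (\<forall>p\<in>V \<rightarrow> carrier_vec n. (\<forall>w\<in>W. qnorm (p w) \<noteq> 0) \<longrightarrow> g p \<noteq> 0 \<longrightarrow>
      (\<exists>l. (\<forall>w\<in>W. (l w)\<^sup>2 = qnorm (p w)) \<and>
        f (\<lambda>w. if w \<in> W then (1 / l w) \<cdot>\<^sub>v p w else p w) \<noteq> 0))"
    by (rule bexE) (rule that)
  note g_root = conjunct2[OF g_prop, THEN bspec, THEN mp, THEN mp]
  have v: "v \<in> V" using insert by simp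
  obtain a b N where ab: "a \<in> polynomial_functions n V" "b \<in> polynomial_functions n V"
    and eq: "\<And>p l. p \<in> V \<rightarrow> carrier_vec n \<Longrightarrow> l \<noteq> 0 \<Longrightarrow> l\<^sup>2 = qnorm (p v) \<Longrightarrow>
      qnorm (p v) ^ N * g (p(v := (1 / l) \<cdot>\<^sub>v p v)) = a p + l * b p"
    using normalise_one_vertex[OF g v] by metis
  \<comment> \<open>At the normalised point \<open>x\<close> the root \<open>l = 1\<close> is admissible.\<close>
  have "x(v := (1 / 1) \<cdot>\<^sub>v x v) = x" by auto
  then have "a x + b x \<noteq> 0" using eq[OF x(1), of 1] x(2) v conjunct1[OF g_prop] by simp
  then have "\<exists>h\<in>{a, b}. h x \<noteq> 0" by auto
  then obtain h where h: "h \<in> {a, b}" "h x \<noteq> 0" by blast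
  have "\<exists>l. (\<forall>w\<in>insert v W. (l w)\<^sup>2 = qnorm (p w)) \<and>
      f (\<lambda>w. if w \<in> insert v W then (1 / l w) \<cdot>\<^sub>v p w else p w) \<noteq> 0"
    if p: "p \<in> V \<rightarrow> carrier_vec n" "\<forall>w\<in>insert v W. qnorm (p w) \<noteq> 0" "h p \<noteq> 0" for p
  proof -
    define c where "c = csqrt (qnorm (p v))"
    have c: "c\<^sup>2 = qnorm (p v)" "c \<noteq> 0" using p by (auto simp: c_def)
    have "a p + c * b p \<noteq> 0 \<or> a p + (- c) * b p \<noteq> 0"
    proof (rule ccontr)
      assume "\<not> ?thesis"
      then have sum: "a p + c * b p = 0" and "a p + (- c) * b p = 0" by blast+
      then have diff: "a p - c * b p = 0" by simp
      have "2 * a p = (a p + c * b p) + (a p - c * b p)" by simp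
      then have "a p = 0" unfolding sum diff by simp
      moreover from this have "c * b p = 0" using sum by simp
      ultimately show False using h(1) p(3) c(2) by auto
    qed
    then obtain m where m: "m\<^sup>2 = qnorm (p v)" "m \<noteq> 0" "a p + m * b p \<noteq> 0"
      using c by (metis neg_equal_0_iff_equal power2_minus)
    define p' where "p' = p(v := (1 / m) \<cdot>\<^sub>v p v)"
    have "g p' \<noteq> 0" using eq[OF p(1) m(2,1)] m(3) by (auto simp: p'_def)
    moreover have "p' \<in> V \<rightarrow> carrier_vec n" using p(1) by (auto simp: p'_def Pi_iff)
    moreover have p'_W: "p' w = p w" if "w \<in> W" for w
      using that insert.hyps by (auto simp: p'_def)
    ultimately obtain l where l: "\<forall>w\<in>W. (l w)\<^sup>2 = qnorm (p w)"
      "f (\<lambda>w. if w \<in> W then (1 / l w) \<cdot>\<^sub>v p' w else p' w) \<noteq> 0"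
      using g_root[of p'] p(2) by auto
    have "(\<lambda>w. if w \<in> insert v W then (1 / (l(v := m)) w) \<cdot>\<^sub>v p w else p w) =
        (\<lambda>w. if w \<in> W then (1 / l w) \<cdot>\<^sub>v p' w else p' w)"
      using insert.hyps by (auto simp: p'_def fun_eq_iff)
    then show ?thesis
      using l m(1) insert.hyps by (intro exI[of _ "l(v := m)"]) auto
  qed
  then show ?case using h ab by (intro bexI[of _ h]) auto
qed


section \<open>Transferring general points\<close>

text \<open>The polynomial for the cone is that of \<open>eliminate_square_roots\<close>, evaluated at the differences
  \<open>p\<^sub>v - p\<^sub>z\<close>, times the product of all \<open>\<parallel>p\<^sub>v - p\<^sub>z\<parallel>\<^sup>2\<close>. It does not vanish at the cone over the
  given spherical realisation, whose spokes all have norm \<open>1\<close>.\<close>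

lemma holds_generally_cone_if_spherical:
  assumes G: "finite_simple_graph G" "z \<notin> verts G"
    and "holds_generally (Suc d) (verts G) (spherical_realisations d G)
      (\<lambda>x. ecard (spherical_congruence_classes d G x) = k)"
  shows "holds_generally (Suc d) (insert z (verts G)) (realisations (Suc d) (cone G z))
      (\<lambda>p. ecard (congruence_classes (Suc d) (cone G z) p) = k)"
proof -
  let ?V = "verts G" and ?n = "Suc d"
  let ?X = "realisations ?n (cone G z)"
  have fin: "finite ?V" using G(1) by (simp add: finite_simple_graph_def)
  obtain f x where f: "f \<in> polynomial_functions ?n ?V"
    and x: "x \<in> spherical_realisations d G" "f x \<noteq> 0"
    and f_k: "\<And>y. y \<in> spherical_realisations d G \<Longrightarrow> f y \<noteq> 0 \<Longrightarrow>
      ecard (spherical_congruence_classes d G y) = k"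
    using assms(3) unfolding holds_generally_iff by blast
  have x_car: "x \<in> ?V \<rightarrow> carrier_vec ?n" using spherical_realisation_carrier[OF x(1)] by blast
  have x_qnorm: "\<forall>v\<in>?V. qnorm (x v) = 1" using spherical_realisation_qnorm[OF x(1)] by blast
  obtain g where g: "g \<in> polynomial_functions ?n ?V" and
    g_prop: "g x \<noteq> 0 \<and> (\<forall>a\<in>?V \<rightarrow> carrier_vec ?n. (\<forall>v\<in>?V. qnorm (a v) \<noteq> 0) \<longrightarrow> g a \<noteq> 0 \<longrightarrow>
      (\<exists>l. (\<forall>v\<in>?V. (l v)\<^sup>2 = qnorm (a v)) \<and>
        f (\<lambda>v. if v \<in> ?V then (1 / l v) \<cdot>\<^sub>v a v else a v) \<noteq> 0))"
    using eliminate_square_roots[OF fin subset_refl f x_car x_qnorm, OF x(2)]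
    by (rule bexE) (rule that)
  note g_root = conjunct2[OF g_prop, THEN bspec, THEN mp, THEN mp]
  define T where "T p = (\<lambda>v\<in>?V. p v - p z)" for p :: "'a \<Rightarrow> complex vec"
  have car: "p v \<in> carrier_vec ?n" if "p \<in> ?X" "v \<in> insert z ?V" for p v
    using that by (auto simp: realisations_def)
  have T_poly: "\<exists>h\<in>polynomial_functions ?n (insert z ?V). \<forall>p\<in>?X. T p v $ i = h p"
    if "v \<in> ?V" "i < ?n" for v i
  proof (intro bexI ballI)
    fix p assume "p \<in> ?X"
    then have "p v \<in> carrier_vec ?n" "p z \<in> carrier_vec ?n" using car that by auto
    then show "T p v $ i = p v $ i - p z $ i" using that by (simp add: T_def)
  qed (use that in \<open>auto intro!: polynomial_functions_diff polynomial_functions.coordinate\<close>)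
  have "\<exists>g'\<in>polynomial_functions ?n (insert z ?V). \<forall>p\<in>?X. g (T p) = g' p"
    by (rule polynomial_substitution[OF g]) (rule T_poly)
  then obtain g' where g': "g' \<in> polynomial_functions ?n (insert z ?V)" "\<And>p. p \<in> ?X \<Longrightarrow> g (T p) = g' p"
    by blast
  have "\<forall>v\<in>?V. \<exists>h\<in>polynomial_functions ?n (insert z ?V). \<forall>p\<in>insert z ?V \<rightarrow> carrier_vec ?n. qnorm (p v - p z) = h p"
    by (intro ballI qnorm_diff_polynomial) auto
  then obtain Q where Q: "\<And>v. v \<in> ?V \<Longrightarrow> Q v \<in> polynomial_functions ?n (insert z ?V)"
      "\<And>v p. v \<in> ?V \<Longrightarrow> p \<in> ?X \<Longrightarrow> qnorm (p v - p z) = Q v p"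
    using car by (metis Pi_I)
  define h where "h p = g' p * (\<Prod>v\<in>?V. Q v p)" for p
  have "h \<in> polynomial_functions ?n (insert z ?V)"
    unfolding h_def by (intro polynomial_functions.mult polynomial_functions_prod g' Q fin)
  moreover have "\<exists>p\<in>?X. h p \<noteq> 0"
  proof
    let ?p = "scaled_cone ?n G z (\<lambda>_. 1) x"
    show p: "?p \<in> ?X" using scaled_cone_realisation[OF x(1)] .
    have eq: "?p v - ?p z = x v" if "v \<in> ?V" for v
      using spherical_realisation_carrier[OF x(1) that] that by (simp add: scaled_cone_simps[OF G(2)])
    then have "T ?p = x"
      using x(1) by (auto simp: T_def fun_eq_iff spherical_realisations_def PiE_def extensional_def)
    moreover have "Q v ?p = 1" if "v \<in> ?V" for v
      using eq[OF that] Q(2)[OF that p] spherical_realisation_qnorm[OF x(1) that] by simp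
    ultimately show "h ?p \<noteq> 0" using conjunct1[OF g_prop] g'(2)[OF p] by (simp add: h_def)
  qed
  moreover have "ecard (congruence_classes ?n (cone G z) p) = k" if p: "p \<in> ?X" "h p \<noteq> 0" for p
  proof -
    have nz: "qnorm (T p v) \<noteq> 0" if "v \<in> ?V" for v
      using p fin Q(2)[OF that p(1)] that by (auto simp: h_def T_def)
    have T_car: "T p \<in> ?V \<rightarrow> carrier_vec ?n"
      using car[OF p(1)] by (auto simp: T_def)
    moreover have "g (T p) \<noteq> 0" using p g'(2) by (simp add: h_def)
    ultimately obtain l where l: "\<And>v. v \<in> ?V \<Longrightarrow> (l v)\<^sup>2 = qnorm (T p v)"
      and fl: "f (\<lambda>v. if v \<in> ?V then (1 / l v) \<cdot>\<^sub>v T p v else T p v) \<noteq> 0"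
      using g_root[of "T p"] nz by blast
    define y where "y = (\<lambda>v. if v \<in> ?V then (1 / l v) \<cdot>\<^sub>v T p v else T p v)"
    have l0: "l v \<noteq> 0" if "v \<in> ?V" for v using l[OF that] nz[OF that] by auto
    have "y v \<in> complex_sphere d" if "v \<in> ?V" for v
      using that T_car l[OF that, symmetric] l0[OF that]
      by (auto simp: y_def complex_sphere_def qnorm_smult power_divide)
    then have y: "y \<in> spherical_realisations d G"
      by (auto simp: spherical_realisations_def) (simp add: y_def T_def)
    have "p v - p z = l v \<cdot>\<^sub>v y v" if "v \<in> ?V" for v
      using that l0[OF that] by (simp add: y_def T_def smult_smult_assoc)
    then show ?thesis
      using ecard_congruence_classes_cone[OF G y p(1) l0] f_k[OF y] fl by (simp add: y_def)
  qed
  ultimately show ?thesis unfolding holds_generally_iff by blast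
qed

text \<open>The scalars \<open>l\<^sub>v\<close> are those of one fixed anisotropic realisation \<open>p\<close>; they serve for all
  spherical realisations \<open>y\<close>, because \<open>ecard_congruence_classes_cone\<close> allows arbitrary non-zero
  scalars.\<close>

lemma holds_generally_spherical_if_cone:
  assumes G: "finite_simple_graph G" "z \<notin> verts G"
    and "holds_generally (Suc d) (insert z (verts G)) (realisations (Suc d) (cone G z))
      (\<lambda>p. ecard (congruence_classes (Suc d) (cone G z) p) = k)"
  shows "holds_generally (Suc d) (verts G) (spherical_realisations d G)
      (\<lambda>x. ecard (spherical_congruence_classes d G x) = k)"
proof -
  let ?V = "verts G" and ?n = "Suc d"
  let ?X = "realisations ?n (cone G z)"
  have fin: "finite ?V" using G(1) by (simp add: finite_simple_graph_def)
  obtain f p0 where f: "f \<in> polynomial_functions ?n (insert z ?V)"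
    and p0: "p0 \<in> ?X" "f p0 \<noteq> 0"
    and f_k: "\<And>p. p \<in> ?X \<Longrightarrow> f p \<noteq> 0 \<Longrightarrow> ecard (congruence_classes ?n (cone G z) p) = k"
    using assms(3) unfolding holds_generally_iff by blast
  obtain p where p: "p \<in> ?X" "f p \<noteq> 0" and nz: "\<And>v. v \<in> ?V \<Longrightarrow> qnorm (p v - p z) \<noteq> 0"
    using exists_anisotropic[OF f, of z p0] fin p0 G(2) unfolding realisations_def by auto
  have car: "p v \<in> carrier_vec ?n" if "v \<in> insert z ?V" for v
    using that p(1) by (auto simp: realisations_def)
  define l where "l v = csqrt (qnorm (p v - p z))" for v
  have l: "l v \<noteq> 0" "(l v)\<^sup>2 = qnorm (p v - p z)" if "v \<in> ?V" for v
    using nz[OF that] by (auto simp: l_def)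
  define T where "T y = (\<lambda>v\<in>insert z ?V. if v = z then p z else p z + l v \<cdot>\<^sub>v y v)"
    for y :: "'a \<Rightarrow> complex vec"
  have T_poly: "\<exists>h\<in>polynomial_functions ?n ?V. \<forall>y\<in>spherical_realisations d G. T y v $ i = h y"
    if v: "v \<in> insert z ?V" "i < ?n" for v i
  proof (cases "v = z")
    case True
    then show ?thesis
      by (intro bexI[of _ "\<lambda>_. p z $ i"]) (auto simp: T_def intro: polynomial_functions.const)
  next
    case False
    have "T y v $ i = p z $ i + l v * y v $ i" if "y \<in> spherical_realisations d G" for y
    proof -
      have "y v \<in> carrier_vec ?n" "p z \<in> carrier_vec ?n"
        using that v False car by (auto intro: spherical_realisation_carrier)
      then show ?thesis using v False by (simp add: T_def)
    qed
    moreover have "(\<lambda>y. p z $ i + l v * y v $ i) \<in> polynomial_functions ?n ?V"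
      using v False by (intro polynomial_functions.intros) auto
    ultimately show ?thesis by (intro bexI[of _ "\<lambda>y. p z $ i + l v * y v $ i"]) auto
  qed
  have "\<exists>g\<in>polynomial_functions ?n ?V. \<forall>y\<in>spherical_realisations d G. f (T y) = g y"
    by (rule polynomial_substitution[OF f]) (rule T_poly)
  then obtain g where g: "g \<in> polynomial_functions ?n ?V"
    "\<And>y. y \<in> spherical_realisations d G \<Longrightarrow> f (T y) = g y"
    by blast
  have "\<exists>x\<in>spherical_realisations d G. g x \<noteq> 0"
  proof
    let ?x = "\<lambda>v\<in>?V. (1 / l v) \<cdot>\<^sub>v (p v - p z)"
    have "?x v \<in> complex_sphere d" if "v \<in> ?V" for v
      using that car[of v] car[of z] l(1)[OF that] l(2)[OF that, symmetric]
      by (simp add: complex_sphere_def qnorm_smult power_divide)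
    then show x: "?x \<in> spherical_realisations d G"
      by (simp add: spherical_realisations_def)
    have "T ?x v = p v" for v
    proof (cases "v \<in> ?V")
      case True
      have "p v \<in> carrier_vec ?n" "p z \<in> carrier_vec ?n" using True car by auto
      then have "p z + (p v - p z) = p v" by auto
      then show ?thesis using True G(2) l(1)[OF True] by (auto simp: T_def smult_smult_assoc)
    next
      case False
      then show ?thesis using p(1) by (auto simp: T_def realisations_def PiE_def extensional_def)
    qed
    then have "T ?x = p" by blast
    then show "g ?x \<noteq> 0" using g(2)[OF x] p(2) by simp
  qed
  moreover have "ecard (spherical_congruence_classes d G y) = k"
    if y: "y \<in> spherical_realisations d G" "g y \<noteq> 0" for y
  proof -
    have y_car: "y v \<in> carrier_vec ?n" if "v \<in> ?V" for v
      using spherical_realisation_carrier[OF y(1) that] .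
    have TX: "T y \<in> ?X"
      using car y_car by (auto simp: T_def realisations_def)
    have "T y v - T y z = l v \<cdot>\<^sub>v y v" if "v \<in> ?V" for v
      using that G(2) car[of z] y_car[OF that] by (auto simp: T_def)
    then show ?thesis
      using ecard_congruence_classes_cone[OF G y(1) TX l(1)] f_k[OF TX] g(2)[OF y(1)] y(2) by simp
  qed
  ultimately show ?thesis using g(1) unfolding holds_generally_iff by blast
qed

theorem theorem1p2:
  fixes G :: "'a graph" and z :: 'a and d :: nat
  assumes "d > 0"
    and "finite_simple_graph G"
    and "z \<notin> verts G"
  shows "spherical_realisation_number d G = realisation_number (d + 1) (cone G z)"
proof -
  have "finite (verts G)" using assms(2) by (simp add: finite_simple_graph_def)
  then have card: "card (verts (cone G z)) = Suc (card (verts G))" using assms(3) by simp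
  have "holds_generally (Suc d) (verts G) (spherical_realisations d G)
        (\<lambda>x. ecard (spherical_congruence_classes d G x) = k) \<longleftrightarrow>
      holds_generally (Suc d) (insert z (verts G)) (realisations (Suc d) (cone G z))
        (\<lambda>p. ecard (congruence_classes (Suc d) (cone G z) p) = k)" for k
    using holds_generally_cone_if_spherical[OF assms(2,3)]
      holds_generally_spherical_if_cone[OF assms(2,3)] by blast
  then show ?thesis
    unfolding spherical_realisation_number_def realisation_number_def card
    by (simp add: complete_graph_cone_iff[OF assms(2,3)])
qed

end
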